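(* Let $G$ be a group acting sharply 2-transitively on a set $X$ with $|X|\geq 4$. (1) If the action of $G$ on $X$ is not of characteristic 2, then $G$ has at least 4 conjugacy classes. (2) If the action of $G$ on $X$ is of characteristic 2, then $G$ has at least 3 conjugacy classes, and $G$ has at least 4 conjugacy classes unless $G\simeq K^*\ltimes K$ for some near-field $K$ such that all non-trivial elements of $K^*$ are conjugate (in $K^*$).
   Context: An action of a group $G$ on a set $X$ with at least two elements is sharply 2-transitive if for any two pairs $(x_1,x_2)$ and $(y_1,y_2)$ of distinct elements of $X$ (i.e. $x_1\neq x_2$ and $y_1\neq y_2$) there exists a unique element of $G$ mapping $(x_1,x_2)$ to $(y_1,y_2)$. An involution is an element of order 2. The sharply 2-transitive action of $G$ on $X$ is of characteristic 2 if involutions of $G$ have no fixed point in $X$. A near-field is a structure $(K,+,\cdot)$ satisfying the axioms of a skew field except that only one of the two distributive laws, $a(b+c)=ab+ac$, is required; $K^*=K\setminus\{0\}$ is its multiplicative group, and $K^*\ltimes K$ is the semidirect product with respect to the action of $K^*$ on the additive group of $K$ by left multiplication. The class of the trivial element is counted among the conjugacy classes. *)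

theory Defs
  imports "HOL-Algebra.Group_Action" "HOL-Algebra.Multiplicative_Group"
begin

text \<open>\<open>card\<close> is 0 on infinite sets, so lower bounds on sizes are guarded by finiteness.\<close>

definition has_at_least :: "nat \<Rightarrow> 'a set \<Rightarrow> bool" where
  "has_at_least n A \<longleftrightarrow> (finite A \<longrightarrow> n \<le> card A)"

locale sharply_2_transitive_action = group_action G X \<phi> for G (structure) and X and \<phi> +
  assumes two_points: "has_at_least 2 X"
    and sharply_2_transitive:
      "\<lbrakk> x\<^sub>1 \<in> X; x\<^sub>2 \<in> X; x\<^sub>1 \<noteq> x\<^sub>2; y\<^sub>1 \<in> X; y\<^sub>2 \<in> X; y\<^sub>1 \<noteq> y\<^sub>2 \<rbrakk>
        \<Longrightarrow> \<exists>!g \<in> carrier G. \<phi> g x\<^sub>1 = y\<^sub>1 \<and> \<phi> g x\<^sub>2 = y\<^sub>2"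

definition involution :: "('a, 'm) monoid_scheme \<Rightarrow> 'a \<Rightarrow> bool" where
  "involution G g \<longleftrightarrow> g \<in> carrier G \<and> group.ord G g = 2"

definition char_2_action ::
    "('a, 'm) monoid_scheme \<Rightarrow> 'b set \<Rightarrow> ('a \<Rightarrow> 'b \<Rightarrow> 'b) \<Rightarrow> bool" where
  "char_2_action G X \<phi> \<longleftrightarrow> (\<forall>g. involution G g \<longrightarrow> (\<forall>x \<in> X. \<phi> g x \<noteq> x))"

definition conjugation :: "('a, 'm) monoid_scheme \<Rightarrow> 'a \<Rightarrow> 'a \<Rightarrow> 'a" where
  "conjugation G g = (\<lambda>h \<in> carrier G. g \<otimes>\<^bsub>G\<^esub> h \<otimes>\<^bsub>G\<^esub> inv\<^bsub>G\<^esub> g)"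

definition conjugate_in :: "('a, 'm) monoid_scheme \<Rightarrow> 'a \<Rightarrow> 'a \<Rightarrow> bool" where
  "conjugate_in G a b \<longleftrightarrow> b \<in> orbit G (conjugation G) a"

definition conjugacy_classes :: "('a, 'm) monoid_scheme \<Rightarrow> 'a set set" where
  "conjugacy_classes G = orbits G (carrier G) (conjugation G)"

text \<open>The axioms of a skew field without right distributivity. That
  \<open>\<zero> \<otimes> a = \<zero>\<close> need not be assumed: it follows from
  associativity, \<open>\<zero> \<otimes> \<zero> = \<zero>\<close> and \<open>\<one> \<noteq> \<zero>\<close>.\<close>

locale near_field = abelian_group K + monoid K for K (structure) +
  assumes left_distr:
      "\<lbrakk> a \<in> carrier K; b \<in> carrier K; c \<in> carrier K \<rbrakk>
        \<Longrightarrow> a \<otimes> (b \<oplus> c) = a \<otimes> b \<oplus> a \<otimes> c"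
    and one_not_zero: "\<one> \<noteq> \<zero>"
    and near_field_Units: "Units K = carrier K - {\<zero>}"

text \<open>\<open>H \<ltimes> N\<close> for an action \<open>\<theta>\<close> of \<open>H\<close> on the left of \<open>N\<close> by automorphisms;
  \<open>(h, n)\<close> stands for the product \<open>n h\<close>.\<close>

definition semidirect_prod ::
    "('h, 'm) monoid_scheme \<Rightarrow> ('n, 'k) monoid_scheme \<Rightarrow> ('h \<Rightarrow> 'n \<Rightarrow> 'n) \<Rightarrow> ('h \<times> 'n) monoid" where
  "semidirect_prod H N \<theta> =
    \<lparr>carrier = carrier H \<times> carrier N,
     mult = (\<lambda>(h, n) (h', n'). (h \<otimes>\<^bsub>H\<^esub> h', n \<otimes>\<^bsub>N\<^esub> \<theta> h n')),
     one = (\<one>\<^bsub>H\<^esub>, \<one>\<^bsub>N\<^esub>)\<rparr>"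

text \<open>\<open>K\<^sup>* \<ltimes> K\<close>, with \<open>(a, b)\<close> corresponding to the affine map \<open>x \<mapsto> b + a x\<close>.\<close>

definition near_field_affine_group :: "('a, 'm) ring_scheme \<Rightarrow> ('a \<times> 'a) monoid" where
  "near_field_affine_group K = semidirect_prod (mult_of K) (add_monoid K) (mult K)"

lemma (in near_field) mult_of_eq_units_of: "mult_of K = units_of K"
  by (simp add: mult_of_def units_of_def near_field_Units)

lemma (in near_field) group_mult_of: "group (mult_of K)"
  by (simp add: mult_of_eq_units_of units_group)

end

theory Submission
  imports Defs
begin

text \<open>
  Swapping the points of a pair shows that involutions exist, and since an involution is
  determined by any pair that it swaps, sharp 2-transitivity makes all of them conjugate. Having a
  fixed point and being an involution are conjugacy invariants, so the task is to find enough
  elements that these invariants separate.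

  If involutions have fixed points, then an involution is determined by its fixed point
  (\<open>involution_fixing_point_unique\<close>). The product of two distinct involutions therefore
  has no fixed point, and so is not an involution. A point stabilizer acts regularly on the at
  least 3 other points, so it contains an element that is neither trivial nor its unique involution.
  The identity, an involution, this element and the product represent 4 conjugacy classes.

  If involutions have no fixed points, then the identity, an involution and a non-trivial element
  of a point stabilizer represent 3 classes. Suppose that there are no others. Elements without
  fixed points are then involutions. The product of two distinct involutions still has no fixed
  point, so it is an involution as well, and the involutions together with the identity form a
  normal subgroup \<open>N\<close> of exponent 2, hence abelian, which acts regularly on \<open>X\<close>. For any
  regular normal abelian subgroup and any distinct points \<open>z\<close>, \<open>u\<close>, the set \<open>X\<close> becomes a
  near-field with zero \<open>z\<close> and unit \<open>u\<close>: addition comes from identifying \<open>X\<close> with \<open>N\<close> via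
  \<open>t \<mapsto> t z\<close>, and multiplication from identifying \<open>X - {z}\<close> with the stabilizer of \<open>z\<close> via
  \<open>g \<mapsto> g u\<close>. The decomposition of \<open>G\<close> into \<open>N\<close> and the stabilizer of \<open>z\<close> is the isomorphism
  with the affine group (\<open>iso_near_field_affine_group\<close>). Finally, all non-trivial elements of
  the stabilizer of \<open>z\<close> are conjugate in \<open>G\<close>; as \<open>z\<close> is the only fixed point of each, a
  conjugating element fixes \<open>z\<close>, so that they are conjugate in the stabilizer, which is the
  multiplicative group.
\<close>

section \<open>Lower bounds on sizes and on numbers of conjugacy classes\<close>

lemma has_at_least_avoid:
  assumes "has_at_least n A" "finite S" "card S < n"
  obtains x where "x \<in> A" "x \<notin> S"
proof -
  have "\<not> A \<subseteq> S"
    using assms card_mono[of S A] finite_subset[of A S] unfolding has_at_least_def by fastforce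
  then show ?thesis using that by blast
qed

lemma has_at_least_image:
  assumes "finite S" "inj_on f S" "f ` S \<subseteq> A"
  shows "has_at_least (card S) A"
  using assms by (metis card_image card_mono has_at_least_def)

lemma (in group) conjugate_in_iff:
  assumes "a \<in> carrier G"
  shows "conjugate_in G a b \<longleftrightarrow> (\<exists>g\<in>carrier G. b = g \<otimes> a \<otimes> inv g)"
  using assms by (auto simp: conjugate_in_def orbit_def conjugation_def)

lemma (in group) conjugation_action: "group_action G (carrier G) (conjugation G)"
  using action_by_conjugation unfolding conjugation_def .

lemma (in group) conjugate_in_refl:
  assumes "a \<in> carrier G"
  shows "conjugate_in G a a"
  unfolding conjugate_in_def using group_action.orbit_refl[OF conjugation_action assms] .

lemma (in group) conjugate_in_sym:
  assumes "a \<in> carrier G" "b \<in> carrier G" "conjugate_in G a b"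
  shows "conjugate_in G b a"
  using assms group_action.orbit_sym[OF conjugation_action] unfolding conjugate_in_def by blast

lemma (in group) has_at_least_conjugacy_classes:
  assumes "finite S" "S \<subseteq> carrier G" "pairwise (\<lambda>a b. \<not> conjugate_in G a b) S"
  shows "has_at_least (card S) (conjugacy_classes G)"
proof (rule has_at_least_image)
  show "inj_on (orbit G (conjugation G)) S"
  proof (rule inj_onI, rule ccontr)
    fix a b
    assume ab: "a \<in> S" "b \<in> S" "a \<noteq> b"
      and eq: "orbit G (conjugation G) a = orbit G (conjugation G) b"
    have "conjugate_in G b b"
      using ab assms conjugate_in_refl by blast
    then have "conjugate_in G a b"
      unfolding conjugate_in_def eq .
    with ab assms(3) show False by (simp add: pairwise_def)
  qed
  show "orbit G (conjugation G) ` S \<subseteq> conjugacy_classes G"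
    using assms(2) by (auto simp: conjugacy_classes_def orbits_def)
qed fact

lemma (in group) involution_iff:
  "involution G g \<longleftrightarrow> g \<in> carrier G \<and> g \<noteq> \<one> \<and> g \<otimes> g = \<one>"
proof -
  have "ord g = 2 \<longleftrightarrow> g \<noteq> \<one> \<and> g \<otimes> g = \<one>" if g: "g \<in> carrier G"
  proof -
    have "g \<otimes> g = \<one> \<longleftrightarrow> ord g dvd 2"
      using pow_eq_id[OF g, of 2] g by (simp add: numeral_2_eq_2)
    moreover have "ord g dvd 2 \<longleftrightarrow> ord g = 1 \<or> ord g = 2"
    proof
      assume "ord g dvd 2"
      moreover from this have "ord g \<le> 2" by (rule dvd_imp_le) simp
      ultimately show "ord g = 1 \<or> ord g = 2" by (cases "ord g = 0") auto
    qed auto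
    ultimately show ?thesis using ord_eq_1[OF g] by auto
  qed
  then show ?thesis unfolding involution_def by auto
qed

lemma (in group) conjugate_in_one_iff:
  assumes "a \<in> carrier G" "conjugate_in G a b"
  shows "b = \<one> \<longleftrightarrow> a = \<one>"
proof -
  obtain g where g: "g \<in> carrier G" "b = g \<otimes> a \<otimes> inv g"
    using assms conjugate_in_iff by auto
  have "b = \<one> \<longleftrightarrow> g \<otimes> a = g"
    using g assms(1) inv_solve_right'[of \<one> "g \<otimes> a" g] by auto
  then show ?thesis
    using g assms(1) by simp
qed

lemma (in group) conjugate_in_involution_iff:
  assumes "a \<in> carrier G" "conjugate_in G a b"
  shows "involution G b \<longleftrightarrow> involution G a"
proof -
  obtain g where g: "g \<in> carrier G" "b = g \<otimes> a \<otimes> inv g"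
    using assms conjugate_in_iff by auto
  have "b \<otimes> b = g \<otimes> (a \<otimes> a) \<otimes> inv g"
    using g assms(1) by (simp add: m_assoc inv_solve_left')
  then have "conjugate_in G (a \<otimes> a) (b \<otimes> b)"
    using g assms(1) conjugate_in_iff by auto
  then show ?thesis
    using conjugate_in_one_iff[of "a \<otimes> a" "b \<otimes> b"] conjugate_in_one_iff[OF assms] assms(1) g
    by (auto simp only: involution_iff m_closed inv_closed)
qed

text \<open>The classes of \<open>\<one>\<close> and \<open>i\<close> contain neither \<open>g\<close> nor \<open>h\<close>, because conjugates share their order; only
  \<open>g\<close> and \<open>h\<close> have to be told apart by other means.\<close>

lemma (in group) has_at_least_4_conjugacy_classes:
  assumes "involution G i"
    and g: "g \<in> carrier G" "g \<noteq> \<one>" "\<not> involution G g"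
    and h: "h \<in> carrier G" "h \<noteq> \<one>" "\<not> involution G h"
    and "\<not> conjugate_in G g h"
  shows "has_at_least 4 (conjugacy_classes G)"
proof -
  have i: "involution G i" "i \<in> carrier G" "i \<noteq> \<one>" "\<not> involution G \<one>"
    using assms(1) by (auto simp: involution_iff)
  have not_hg: "\<not> conjugate_in G h g"
    using assms conjugate_in_sym by blast
  have one: "\<not> conjugate_in G a \<one>" "\<not> conjugate_in G \<one> a" if "a \<in> carrier G" "a \<noteq> \<one>" for a
    using conjugate_in_one_iff that by blast+
  have inv: "\<not> conjugate_in G a i" "\<not> conjugate_in G i a"
    if "a \<in> carrier G" "\<not> involution G a" for a
    using conjugate_in_involution_iff that i by blast+
  have "pairwise (\<lambda>a b. \<not> conjugate_in G a b) {\<one>, i, g, h}"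
    using one inv not_hg assms i by (auto simp: pairwise_insert)
  moreover have "g \<noteq> h" using assms conjugate_in_refl by blast
  then have "card {\<one>, i, g, h} = 4"
    using g h i by (subst card_insert_disjoint | auto)+
  ultimately show ?thesis
    using has_at_least_conjugacy_classes[of "{\<one>, i, g, h}"] g h i by simp
qed

section \<open>Involutions and fixed points in sharply 2-transitive groups\<close>

context sharply_2_transitive_action
begin

sublocale group G
  using group_hom group_hom.axioms(1) by auto

lemma act_closed: "g \<in> carrier G \<Longrightarrow> x \<in> X \<Longrightarrow> \<phi> g x \<in> X"
  using element_image by blast

lemma act_one: "x \<in> X \<Longrightarrow> \<phi> \<one> x = x"
  by (metis id_eq_one restrict_apply')

lemma act_mult: "g \<in> carrier G \<Longrightarrow> h \<in> carrier G \<Longrightarrow> x \<in> X \<Longrightarrow> \<phi> (g \<otimes> h) x = \<phi> g (\<phi> h x)"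
  by (rule composition_rule)

lemma act_inv_eq_iff:
  assumes "g \<in> carrier G" "x \<in> X" "y \<in> X"
  shows "\<phi> (inv g) y = x \<longleftrightarrow> \<phi> g x = y"
  using assms orbit_sym_aux by (metis inv_closed inv_inv)

lemma act_eq_iff:
  assumes "g \<in> carrier G" "x \<in> X" "y \<in> X"
  shows "\<phi> g x = \<phi> g y \<longleftrightarrow> x = y"
  using assms by (metis orbit_sym_aux)

lemma act_conjugate:
  assumes "g \<in> carrier G" "h \<in> carrier G" "x \<in> X"
  shows "\<phi> (g \<otimes> h \<otimes> inv g) (\<phi> g x) = \<phi> g (\<phi> h x)"
  using assms by (simp add: act_mult act_closed orbit_sym_aux)

lemma exists_mover:
  assumes "x\<^sub>1 \<in> X" "x\<^sub>2 \<in> X" "x\<^sub>1 \<noteq> x\<^sub>2" "y\<^sub>1 \<in> X" "y\<^sub>2 \<in> X" "y\<^sub>1 \<noteq> y\<^sub>2"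
  obtains g where "g \<in> carrier G" "\<phi> g x\<^sub>1 = y\<^sub>1" "\<phi> g x\<^sub>2 = y\<^sub>2"
  using sharply_2_transitive[OF assms] by blast

lemma eq_if_agree_at_two_points:
  assumes "g \<in> carrier G" "h \<in> carrier G" "x \<in> X" "y \<in> X" "x \<noteq> y"
    and "\<phi> g x = \<phi> h x" "\<phi> g y = \<phi> h y"
  shows "g = h"
proof -
  have "\<exists>!k \<in> carrier G. \<phi> k x = \<phi> h x \<and> \<phi> k y = \<phi> h y"
    using assms by (intro sharply_2_transitive) (auto simp: act_closed act_eq_iff)
  then show ?thesis using assms by blast
qed

lemma conjugate_has_fixed_point_iff:
  assumes "a \<in> carrier G" "conjugate_in G a b"
  shows "(\<exists>x\<in>X. \<phi> b x = x) \<longleftrightarrow> (\<exists>x\<in>X. \<phi> a x = x)"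
proof -
  have transfer: "\<exists>x\<in>X. \<phi> d x = x"
    if cd: "c \<in> carrier G" "conjugate_in G c d" "\<exists>x\<in>X. \<phi> c x = x" for c d
  proof -
    obtain g x where "g \<in> carrier G" "d = g \<otimes> c \<otimes> inv g" "x \<in> X" "\<phi> c x = x"
      using cd conjugate_in_iff by auto
    then show ?thesis using act_conjugate[of g c x] cd(1) act_closed by auto
  qed
  have "b \<in> carrier G" using assms conjugate_in_iff by auto
  then show ?thesis using transfer assms conjugate_in_sym by blast
qed

text \<open>A permutation of \<open>X\<close> in \<open>G\<close> that agrees with the identity at two points is the identity.\<close>

lemma unique_fixed_point:
  assumes "g \<in> carrier G" "g \<noteq> \<one>" "x \<in> X" "y \<in> X" "\<phi> g x = x" "\<phi> g y = y"
  shows "x = y"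
  using eq_if_agree_at_two_points[of g \<one> x y] assms by (auto simp: act_one)

lemma involution_swaps:
  assumes "involution G i" "x \<in> X"
  shows "\<phi> i (\<phi> i x) = x"
  using assms act_mult[of i i x] by (auto simp: involution_iff act_one)

text \<open>The square of an element that swaps two points fixes both of them, so it is trivial.\<close>

lemma involution_swapping:
  assumes "x \<in> X" "y \<in> X" "x \<noteq> y"
  obtains i where "involution G i" "\<phi> i x = y"
proof -
  obtain i where i: "i \<in> carrier G" "\<phi> i x = y" "\<phi> i y = x"
    using exists_mover[of x y y x] assms by blast
  have "i \<otimes> i = \<one>"
    using assms i by (intro eq_if_agree_at_two_points[of _ _ x y]) (auto simp: act_mult act_one)
  moreover have "i \<noteq> \<one>"
    using i assms act_one by auto
  ultimately show ?thesis
    using that i by (auto simp: involution_iff)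
qed

text \<open>Both involutions swap the same two points.\<close>

lemma involutions_eq_if_agree:
  assumes "involution G i" "involution G j" "x \<in> X" "\<phi> i x = \<phi> j x" "\<phi> i x \<noteq> x"
  shows "i = j"
  using assms involution_swaps[of i x] involution_swaps[of j x]
  by (intro eq_if_agree_at_two_points[of i j x "\<phi> i x"]) (auto simp: involution_iff act_closed)

lemma involution_moves_some_point:
  assumes "involution G i"
  obtains x where "x \<in> X" "\<phi> i x \<noteq> x"
proof -
  obtain x where x: "x \<in> X"
    using has_at_least_avoid[OF two_points, of "{}"] by auto
  obtain y where y: "y \<in> X" "y \<noteq> x"
    using has_at_least_avoid[OF two_points, of "{x}"] by auto
  show ?thesis
    using that unique_fixed_point[of i x y] assms x y by (auto simp: involution_iff)
qed

text \<open>An element that takes a pair swapped by \<open>i\<close> to a pair swapped by \<open>j\<close> conjugates \<open>i\<close> into an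
  involution that agrees with \<open>j\<close> at a point that \<open>j\<close> moves.\<close>

lemma involutions_conjugate:
  assumes "involution G i" "involution G j"
  shows "conjugate_in G i j"
proof -
  obtain x where x: "x \<in> X" "\<phi> i x \<noteq> x"
    using involution_moves_some_point assms(1) .
  obtain y where y: "y \<in> X" "\<phi> j y \<noteq> y"
    using involution_moves_some_point assms(2) .
  have ij: "i \<in> carrier G" "j \<in> carrier G"
    using assms by (auto simp: involution_iff)
  obtain g where g: "g \<in> carrier G" "\<phi> g x = y" "\<phi> g (\<phi> i x) = \<phi> j y"
    using exists_mover[of x "\<phi> i x" y "\<phi> j y"] x y ij by (metis act_closed)
  have conj: "conjugate_in G i (g \<otimes> i \<otimes> inv g)"
    using g ij conjugate_in_iff by blast
  moreover have "involution G (g \<otimes> i \<otimes> inv g)"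
    using conj conjugate_in_involution_iff ij assms(1) by blast
  moreover have "\<phi> (g \<otimes> i \<otimes> inv g) y = \<phi> j y"
    using act_conjugate[of g i x] g ij x by simp
  ultimately show ?thesis
    using involutions_eq_if_agree[of "g \<otimes> i \<otimes> inv g" j y] y assms(2) by auto
qed

text \<open>If \<open>i j\<close> fixes \<open>x\<close>, then \<open>i\<close> and \<open>j\<close> map \<open>x\<close> to the same point. Either they both fix \<open>x\<close>
  or they swap the same two points. The hypothesis \<open>no_common\<close> excludes the former; it holds in
  every characteristic, for different reasons.\<close>

lemma mult_involutions_has_no_fixed_point:
  assumes "involution G i" "involution G j" "i \<noteq> j"
    and no_common: "\<And>x. x \<in> X \<Longrightarrow> \<phi> i x = x \<Longrightarrow> \<phi> j x = x \<Longrightarrow> False"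
    and x: "x \<in> X"
  shows "\<phi> (i \<otimes> j) x \<noteq> x"
proof
  assume fix_x: "\<phi> (i \<otimes> j) x = x"
  have "i \<in> carrier G" "j \<in> carrier G"
    using assms by (auto simp: involution_iff)
  with fix_x x have "\<phi> i (\<phi> j x) = x" by (simp add: act_mult)
  then have "\<phi> j x = \<phi> i x"
    using involution_swaps[OF assms(1), of "\<phi> j x"] \<open>j \<in> carrier G\<close> x act_closed by auto
  then show False
    using no_common[OF x] involutions_eq_if_agree[OF assms(1,2) x] assms(3) by auto
qed

text \<open>For a point \<open>y\<close> different from \<open>x\<close>, an element of the stabilizer of \<open>x\<close> may take \<open>y\<close> to any
  point other than \<open>x\<close>. The images of \<open>y\<close> under \<open>S\<close> and the identity are to be avoided too, which
  explains the bound \<open>card S + 2\<close>.\<close>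

lemma element_fixing_point_outside:
  assumes "has_at_least n X" "finite S" "card S + 2 < n" "x \<in> X"
  obtains g where "g \<in> carrier G" "g \<noteq> \<one>" "g \<notin> S" "\<phi> g x = x"
proof -
  obtain y where y: "y \<in> X" "y \<noteq> x"
    using has_at_least_avoid[OF two_points, of "{x}"] by auto
  let ?A = "insert x (insert y ((\<lambda>s. \<phi> s y) ` S))"
  have "card ?A < n"
    using assms(2,3) card_image_le[OF assms(2), of "\<lambda>s. \<phi> s y"] card_insert_le_m1
    by (simp add: card_insert_if)
  then obtain w where w: "w \<in> X" "w \<notin> ?A"
    using has_at_least_avoid[OF assms(1), of ?A] assms(2) by auto
  obtain g where "g \<in> carrier G" "\<phi> g x = x" "\<phi> g y = w"
    using exists_mover[of x y x w] assms(4) y w by (metis insertCI)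
  then show ?thesis
    using that[of g] w y act_one by auto
qed

text \<open>For \<open>y \<noteq> x\<close>, let \<open>g\<close> fix \<open>y\<close> and take \<open>i y\<close> to \<open>j y\<close>. It conjugates \<open>i\<close> into \<open>j\<close>, so it maps
  the only fixed point \<open>x\<close> of \<open>i\<close> to the only fixed point \<open>x\<close> of \<open>j\<close>. Hence \<open>g\<close> fixes
  both \<open>x\<close> and \<open>y\<close> and is trivial, so that \<open>i y = j y\<close>.\<close>

lemma involution_fixing_point_unique:
  assumes "involution G i" "involution G j" "x \<in> X" "\<phi> i x = x" "\<phi> j x = x"
  shows "i = j"
proof -
  obtain y where y: "y \<in> X" "y \<noteq> x"
    using has_at_least_avoid[OF two_points, of "{x}"] by auto
  have ij: "i \<in> carrier G" "j \<in> carrier G" "i \<noteq> \<one>" "j \<noteq> \<one>"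
    using assms by (auto simp: involution_iff)
  have moved: "\<phi> i y \<noteq> y" "\<phi> j y \<noteq> y"
    using unique_fixed_point[of i x y] unique_fixed_point[of j x y] assms y ij by auto
  obtain g where g: "g \<in> carrier G" "\<phi> g y = y" "\<phi> g (\<phi> i y) = \<phi> j y"
    using exists_mover[of y "\<phi> i y" y "\<phi> j y"] y moved ij by (metis act_closed)
  have "conjugate_in G i (g \<otimes> i \<otimes> inv g)"
    using g ij conjugate_in_iff by blast
  then have inv: "involution G (g \<otimes> i \<otimes> inv g)"
    using conjugate_in_involution_iff ij assms(1) by blast
  have "\<phi> (g \<otimes> i \<otimes> inv g) y = \<phi> j y"
    using act_conjugate[of g i y] g ij y by simp
  then have "g \<otimes> i \<otimes> inv g = j"
    using involutions_eq_if_agree[of "g \<otimes> i \<otimes> inv g" j y] inv y assms(2) moved by auto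
  then have "\<phi> j (\<phi> g x) = \<phi> g x"
    using act_conjugate[of g i x] g ij assms by simp
  then have "\<phi> g x = x"
    using unique_fixed_point[of j "\<phi> g x" x] assms ij g act_closed by auto
  then have "g = \<one>"
    using eq_if_agree_at_two_points[of g \<one> x y] g y assms act_one by auto
  then have "\<phi> i y = \<phi> j y"
    using g y ij act_closed act_one by auto
  then show ?thesis
    using involutions_eq_if_agree[OF assms(1,2)] y moved by auto
qed

lemma has_at_least_4_classes_if_not_char_2:
  assumes "has_at_least 4 X" "\<not> char_2_action G X \<phi>"
  shows "has_at_least 4 (conjugacy_classes G)"
proof -
  obtain i x where i: "involution G i" and x: "x \<in> X" "\<phi> i x = x"
    using assms(2) unfolding char_2_action_def by auto
  have ic: "i \<in> carrier G" "i \<noteq> \<one>"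
    using i by (auto simp: involution_iff)
  obtain y where y: "y \<in> X" "y \<noteq> x"
    using has_at_least_avoid[OF two_points, of "{x}"] by auto
  obtain h where h: "h \<in> carrier G" "\<phi> h x = y"
    using exists_mover[of x y y x] x y by metis
  \<comment> \<open>An involution that fixes \<open>y\<close> differs from \<open>i\<close>, whose only fixed point is \<open>x\<close>.\<close>
  define j where "j = h \<otimes> i \<otimes> inv h"
  have "conjugate_in G i j"
    using h ic conjugate_in_iff unfolding j_def by blast
  then have j: "involution G j"
    using conjugate_in_involution_iff ic i by blast
  have "\<phi> j y = y"
    using act_conjugate[of h i x] h ic x unfolding j_def by simp
  then have "i \<noteq> j"
    using unique_fixed_point[of i x y] ic x y by auto
  have jc: "j \<in> carrier G"
    using j by (auto simp: involution_iff)
  have ij_free: "\<not> (\<exists>z\<in>X. \<phi> (i \<otimes> j) z = z)"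
    using mult_involutions_has_no_fixed_point[OF i j \<open>i \<noteq> j\<close>]
      involution_fixing_point_unique[OF i j] \<open>i \<noteq> j\<close> by blast
  obtain g where g: "g \<in> carrier G" "g \<noteq> \<one>" "g \<notin> {i}" "\<phi> g x = x"
    using element_fixing_point_outside[OF assms(1), of "{i}" x] ic x by auto
  have g_inv: "\<not> involution G g"
    using involution_fixing_point_unique[OF i _ x(1)] x g by blast
  have ij_inv: "\<not> involution G (i \<otimes> j)"
    using involutions_conjugate[OF i] conjugate_has_fixed_point_iff[of i "i \<otimes> j"] ic x ij_free by blast
  have ij_one: "i \<otimes> j \<noteq> \<one>"
    using ij_free x act_one by auto
  show ?thesis
    using has_at_least_4_conjugacy_classes[OF i g(1,2) g_inv _ ij_one ij_inv]
      conjugate_has_fixed_point_iff[OF g(1)] g x ij_free ic jc by blast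
qed

lemma has_at_least_3_classes_if_char_2:
  assumes "has_at_least 3 X" "char_2_action G X \<phi>"
  shows "has_at_least 3 (conjugacy_classes G)"
proof -
  obtain x where x: "x \<in> X"
    using has_at_least_avoid[OF two_points, of "{}"] by auto
  obtain y where y: "y \<in> X" "y \<noteq> x"
    using has_at_least_avoid[OF two_points, of "{x}"] by auto
  obtain i where i: "involution G i"
    using involution_swapping[of x y] x y by auto
  obtain g where g: "g \<in> carrier G" "g \<noteq> \<one>" "\<phi> g x = x"
    using element_fixing_point_outside[OF assms(1), of "{}" x] x by auto
  have g_inv: "\<not> involution G g"
    using assms(2) x g unfolding char_2_action_def by auto
  have ic: "i \<in> carrier G" "i \<noteq> \<one>"
    using i by (auto simp: involution_iff)
  have "\<not> conjugate_in G \<one> i" "\<not> conjugate_in G i \<one>" "\<not> conjugate_in G \<one> g" "\<not> conjugate_in G g \<one>"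
    "\<not> conjugate_in G i g" "\<not> conjugate_in G g i"
    using conjugate_in_one_iff conjugate_in_involution_iff i g g_inv ic by blast+
  then have nonconj: "pairwise (\<lambda>a b. \<not> conjugate_in G a b) {\<one>, i, g}"
    by (auto simp: pairwise_insert)
  have "i \<noteq> g" using i g_inv by auto
  then have "card {\<one>, i, g} = 3"
    using g ic by auto
  then show ?thesis
    using has_at_least_conjugacy_classes[OF _ _ nonconj] g ic by simp
qed

end

section \<open>Near-fields from regular normal abelian subgroups\<close>

locale split_sharply_2_transitive_action = sharply_2_transitive_action G X \<phi>
  for G (structure) and X and \<phi> +
  fixes N and z u
  assumes normal: "N \<lhd> G"
    and commutative: "\<lbrakk> s \<in> N; t \<in> N \<rbrakk> \<Longrightarrow> s \<otimes> t = t \<otimes> s"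
    and regular: "\<lbrakk> x \<in> X; y \<in> X \<rbrakk> \<Longrightarrow> \<exists>!t \<in> N. \<phi> t x = y"
    and z: "z \<in> X" and u: "u \<in> X" and z_neq_u: "z \<noteq> u"
begin

text \<open>\<open>translation b\<close> is \<open>x \<mapsto> b + x\<close> and \<open>dilation a\<close> is \<open>x \<mapsto> a x\<close> in the near-field that
  they are used to define. Only the non-zero \<open>a\<close> have a dilation, which is why the product with
  \<open>z\<close> on the left is set to \<open>z\<close> separately.\<close>

definition translation where
  "translation b = (THE t. t \<in> N \<and> \<phi> t z = b)"

definition dilation where
  "dilation a = (THE g. g \<in> carrier G \<and> \<phi> g z = z \<and> \<phi> g u = a)"

definition coordinates where
  "coordinates =
    \<lparr>carrier = X,
     mult = (\<lambda>a b. if a = z then z else \<phi> (dilation a) b),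
     one = u,
     zero = z,
     add = (\<lambda>a b. \<phi> (translation a) b)\<rparr>"

lemma subgroup_N: "subgroup N G"
  using normal by (rule normal_imp_subgroup)

lemma N_subset: "t \<in> N \<Longrightarrow> t \<in> carrier G"
  using subgroup_N by (rule subgroup.mem_carrier)

lemma translation:
  assumes "b \<in> X"
  shows "translation b \<in> N" "\<phi> (translation b) z = b" "translation b \<in> carrier G"
proof -
  have "translation b \<in> N \<and> \<phi> (translation b) z = b"
    unfolding translation_def by (rule theI'[OF regular[OF z assms]])
  then show "translation b \<in> N" "\<phi> (translation b) z = b" "translation b \<in> carrier G"
    using N_subset by auto
qed

lemma translation_eqI:
  assumes "t \<in> N" "\<phi> t z = b"
  shows "translation b = t"
proof -
  have "b \<in> X" using assms N_subset[of t] act_closed[of t z] z by simp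
  then have "\<exists>!s \<in> N. \<phi> s z = b" by (rule regular[OF z])
  then show ?thesis
    unfolding translation_def by (rule the1_equality) (use assms in simp)
qed

lemma dilation:
  assumes "a \<in> X" "a \<noteq> z"
  shows "dilation a \<in> carrier G" "\<phi> (dilation a) z = z" "\<phi> (dilation a) u = a"
proof -
  have "dilation a \<in> carrier G \<and> \<phi> (dilation a) z = z \<and> \<phi> (dilation a) u = a"
    unfolding dilation_def
    by (rule theI'[OF sharply_2_transitive[OF z u z_neq_u z assms(1) assms(2)[symmetric]]])
  then show "dilation a \<in> carrier G" "\<phi> (dilation a) z = z" "\<phi> (dilation a) u = a"
    by auto
qed

lemma act_neq_z:
  assumes "g \<in> carrier G" "\<phi> g z = z" "x \<in> X" "x \<noteq> z"
  shows "\<phi> g x \<in> X" "\<phi> g x \<noteq> z"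
  using assms act_closed[of g x] act_eq_iff[of g x z] z by auto

lemma dilation_eqI:
  assumes "g \<in> carrier G" "\<phi> g z = z" "\<phi> g u = a"
  shows "dilation a = g"
proof -
  have "a \<in> X" "a \<noteq> z" using assms act_neq_z[of g u] u z_neq_u by auto
  then show ?thesis
    using eq_if_agree_at_two_points[of "dilation a" g z u] dilation assms z u z_neq_u by auto
qed

lemma act_dilation_eq_z_iff:
  assumes "a \<in> X" "a \<noteq> z" "b \<in> X"
  shows "\<phi> (dilation a) b = z \<longleftrightarrow> b = z"
  using dilation[OF assms(1,2)] act_eq_iff[of "dilation a" b z] assms z by simp

text \<open>The next three rules are the associative laws of addition and multiplication and the left
  distributive law of \<open>coordinates\<close>, read off from products in \<open>G\<close>. The last one holds because \<open>N\<close>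
  is normal.\<close>

lemma translation_add:
  assumes "a \<in> X" "b \<in> X"
  shows "translation (\<phi> (translation a) b) = translation a \<otimes> translation b"
  using assms translation z
  by (intro translation_eqI) (simp_all add: act_mult subgroup.m_closed[OF subgroup_N])

lemma dilation_mult:
  assumes "a \<in> X" "a \<noteq> z" "b \<in> X" "b \<noteq> z"
  shows "dilation (\<phi> (dilation a) b) = dilation a \<otimes> dilation b"
  using assms dilation z u by (intro dilation_eqI) (auto simp: act_mult)

lemma dilation_translation:
  assumes "a \<in> X" "a \<noteq> z" "b \<in> X"
  shows "dilation a \<otimes> translation b = translation (\<phi> (dilation a) b) \<otimes> dilation a"
proof -
  note a = dilation[OF assms(1,2)] and b = translation[OF assms(3)]
  have "translation (\<phi> (dilation a) b) = dilation a \<otimes> translation b \<otimes> inv (dilation a)"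
  proof (rule translation_eqI)
    show "dilation a \<otimes> translation b \<otimes> inv (dilation a) \<in> N"
      using normal.inv_op_closed2[OF normal] a b by simp
    show "\<phi> (dilation a \<otimes> translation b \<otimes> inv (dilation a)) z = \<phi> (dilation a) b"
      using act_conjugate[of "dilation a" "translation b" z] a b z by simp
  qed
  then show ?thesis using a b by (simp add: m_assoc)
qed

lemma abelian_group_coordinates: "abelian_group coordinates"
proof (rule abelian_groupI)
  fix x assume x: "x \<in> carrier coordinates"
  then have x: "x \<in> X" by (simp add: coordinates_def)
  let ?y = "\<phi> (inv (translation x)) z"
  have "inv (translation x) \<in> N"
    using translation(1)[OF x] by (rule subgroup.m_inv_closed[OF subgroup_N])
  then have "translation ?y = inv (translation x)"
    by (rule translation_eqI) simp
  then have "\<phi> (translation ?y) x = z"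
    using act_inv_eq_iff translation x z by auto
  moreover have "?y \<in> X"
    using x translation z act_closed by auto
  ultimately show "\<exists>y\<in>carrier coordinates. y \<oplus>\<^bsub>coordinates\<^esub> x = \<zero>\<^bsub>coordinates\<^esub>"
    unfolding coordinates_def by auto
next
  fix x y assume "x \<in> carrier coordinates" "y \<in> carrier coordinates"
  then have x: "x \<in> X" "y \<in> X" by (simp_all add: coordinates_def)
  have "\<phi> (translation x) y = \<phi> (translation x \<otimes> translation y) z"
    using x translation z act_mult by auto
  also have "\<dots> = \<phi> (translation y \<otimes> translation x) z"
    using x translation commutative by auto
  also have "\<dots> = \<phi> (translation y) x"
    using x translation z act_mult by auto
  finally show "x \<oplus>\<^bsub>coordinates\<^esub> y = y \<oplus>\<^bsub>coordinates\<^esub> x"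
    by (simp add: coordinates_def)
next
  fix x assume "x \<in> carrier coordinates"
  moreover have "translation z = \<one>"
    using z act_one subgroup.one_closed[OF subgroup_N] by (intro translation_eqI) auto
  ultimately show "\<zero>\<^bsub>coordinates\<^esub> \<oplus>\<^bsub>coordinates\<^esub> x = x"
    by (simp add: coordinates_def act_one)
qed (use z translation in \<open>auto simp: coordinates_def act_closed translation_add act_mult\<close>)

lemma dilation_u: "dilation u = \<one>"
  using z u act_one by (intro dilation_eqI) auto

lemma monoid_coordinates: "monoid coordinates"
  using z u z_neq_u
  by (intro monoidI)
    (auto simp: coordinates_def act_closed dilation dilation_mult act_mult dilation_u act_one
      act_dilation_eq_z_iff)

lemma Units_coordinates: "Units coordinates = X - {z}"
proof
  show "Units coordinates \<subseteq> X - {z}"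
    using z_neq_u by (auto simp: Units_def coordinates_def)
  show "X - {z} \<subseteq> Units coordinates"
  proof
    fix a assume "a \<in> X - {z}"
    then have a: "a \<in> X" "a \<noteq> z" by auto
    note d = dilation[OF a]
    let ?b = "\<phi> (inv (dilation a)) u"
    have b: "?b \<in> X" "?b \<noteq> z"
      using d act_closed act_inv_eq_iff z u z_neq_u by auto
    have "dilation ?b = inv (dilation a)"
      using d z act_inv_eq_iff by (intro dilation_eqI) auto
    then have "\<phi> (dilation ?b) a = u" "\<phi> (dilation a) ?b = u"
      using d a b act_inv_eq_iff u by auto
    then show "a \<in> Units coordinates"
      using a b by (auto simp: Units_def coordinates_def)
  qed
qed

lemma near_field_coordinates: "near_field coordinates"
proof (intro near_field.intro abelian_group_coordinates monoid_coordinates near_field_axioms.intro)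
  fix a b c
  assume "a \<in> carrier coordinates" "b \<in> carrier coordinates" "c \<in> carrier coordinates"
  then have abc: "a \<in> X" "b \<in> X" "c \<in> X" by (simp_all add: coordinates_def)
  have zz: "\<phi> (translation z) z = z" using translation z by simp
  show "a \<otimes>\<^bsub>coordinates\<^esub> (b \<oplus>\<^bsub>coordinates\<^esub> c)
      = a \<otimes>\<^bsub>coordinates\<^esub> b \<oplus>\<^bsub>coordinates\<^esub> a \<otimes>\<^bsub>coordinates\<^esub> c"
  proof (cases "a = z")
    case True
    then show ?thesis using zz by (simp add: coordinates_def)
  next
    case False
    have "\<phi> (dilation a) (\<phi> (translation b) c) = \<phi> (dilation a \<otimes> translation b) c"
      using abc False dilation translation act_mult by auto
    also have "\<dots> = \<phi> (translation (\<phi> (dilation a) b)) (\<phi> (dilation a) c)"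
      using abc False dilation translation act_mult act_closed by (simp add: dilation_translation)
    finally show ?thesis using False by (simp add: coordinates_def)
  qed
qed (use z_neq_u Units_coordinates in \<open>auto simp: coordinates_def\<close>)

lemma translation_dilation_inj:
  assumes "a \<in> X" "a \<noteq> z" "b \<in> X" "c \<in> X" "c \<noteq> z" "d \<in> X"
    and eq: "translation b \<otimes> dilation a = translation d \<otimes> dilation c"
  shows "a = c \<and> b = d"
proof -
  have "\<phi> (translation b \<otimes> dilation a) z = b" "\<phi> (translation d \<otimes> dilation c) z = d"
    using assms(1-6) dilation translation act_mult z by auto
  then have "b = d" using eq by simp
  then have "dilation a = dilation c"
    using eq assms(1-6) dilation translation by simp
  then have "\<phi> (dilation a) u = \<phi> (dilation c) u" by simp
  then show ?thesis
    using \<open>b = d\<close> assms(1-6) dilation by simp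
qed

lemma translation_dilation_surj:
  assumes "g \<in> carrier G"
  obtains a b where "a \<in> X" "a \<noteq> z" "b \<in> X" "g = translation b \<otimes> dilation a"
proof -
  define b where "b = \<phi> g z"
  have b: "b \<in> X" using assms z act_closed b_def by simp
  note t = translation[OF b]
  define h where "h = inv (translation b) \<otimes> g"
  have h: "h \<in> carrier G" "\<phi> h z = z"
    using assms t z b act_mult act_inv_eq_iff b_def by (auto simp: h_def)
  have "\<phi> h u \<in> X" "\<phi> h u \<noteq> z"
    using h act_neq_z[of h u] u z_neq_u by auto
  moreover have "dilation (\<phi> h u) = h"
    using h by (intro dilation_eqI) auto
  moreover have "g = translation b \<otimes> h"
    using t assms by (simp add: h_def m_assoc[symmetric])
  ultimately show ?thesis using that b by metis
qed

text \<open>The map \<open>(a, b) \<mapsto> translation b \<otimes> dilation a\<close> is bijective onto \<open>G\<close>, and multiplicative by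
  \<open>dilation_translation\<close>; its inverse is the isomorphism.\<close>

lemma iso_near_field_affine_group: "G \<cong> near_field_affine_group coordinates"
proof -
  let ?A = "near_field_affine_group coordinates"
  define f where "f = (\<lambda>(a, b). translation b \<otimes> dilation a)"
  have A: "carrier ?A = (X - {z}) \<times> X"
    by (simp add: near_field_affine_group_def semidirect_prod_def coordinates_def)
  have inj: "inj_on f (carrier ?A)"
  proof (rule inj_onI)
    fix p q assume pq: "p \<in> carrier ?A" "q \<in> carrier ?A" and eq: "f p = f q"
    obtain a b c d where "p = (a, b)" "q = (c, d)" by fastforce
    then show "p = q"
      using pq eq translation_dilation_inj[of a b c d] by (simp add: A f_def)
  qed
  have surj: "f ` carrier ?A = carrier G"
  proof
    show "f ` carrier ?A \<subseteq> carrier G"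
      using translation dilation by (auto simp: A f_def)
    show "carrier G \<subseteq> f ` carrier ?A"
    proof
      fix g assume "g \<in> carrier G"
      then obtain a b where "a \<in> X" "a \<noteq> z" "b \<in> X" "g = translation b \<otimes> dilation a"
        by (rule translation_dilation_surj)
      then show "g \<in> f ` carrier ?A"
        by (intro image_eqI[of _ _ "(a, b)"]) (auto simp: A f_def)
    qed
  qed
  have bij: "bij_betw f (carrier ?A) (carrier G)"
    using inj surj by (simp add: bij_betw_def)
  have mult: "p \<otimes>\<^bsub>?A\<^esub> q \<in> carrier ?A \<and> f (p \<otimes>\<^bsub>?A\<^esub> q) = f p \<otimes> f q"
    if pq: "p \<in> carrier ?A" "q \<in> carrier ?A" for p q
  proof -
    obtain a b c d where "p = (a, b)" "q = (c, d)"
      and abcd: "a \<in> X" "a \<noteq> z" "b \<in> X" "c \<in> X" "c \<noteq> z" "d \<in> X"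
      using pq by (auto simp: A)
    then have prod: "p \<otimes>\<^bsub>?A\<^esub> q = (\<phi> (dilation a) c, \<phi> (translation b) (\<phi> (dilation a) d))"
      by (simp add: near_field_affine_group_def semidirect_prod_def coordinates_def)
    note cl = dilation[OF abcd(1,2)] dilation[OF abcd(4,5)]
      translation[OF abcd(3)] translation[OF abcd(6)]
    have ad: "\<phi> (dilation a) d \<in> X" using cl abcd act_closed by simp
    have "f p \<otimes> f q = translation b \<otimes> (dilation a \<otimes> translation d) \<otimes> dilation c"
      using cl by (simp add: f_def \<open>p = _\<close> \<open>q = _\<close> m_assoc)
    also have "\<dots> = translation b \<otimes> translation (\<phi> (dilation a) d) \<otimes> (dilation a \<otimes> dilation c)"
      using cl ad translation[OF ad] abcd by (simp add: dilation_translation m_assoc)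
    also have "\<dots> = f (p \<otimes>\<^bsub>?A\<^esub> q)"
      using abcd ad by (simp add: prod f_def translation_add dilation_mult)
    finally show ?thesis
      using abcd cl ad by (simp add: prod A act_closed act_dilation_eq_z_iff)
  qed
  let ?g = "inv_into (carrier ?A) f"
  have "?g \<in> hom G ?A"
  proof (rule homI)
    fix g h assume gh: "g \<in> carrier G" "h \<in> carrier G"
    obtain p where p: "p \<in> carrier ?A" "g = f p"
      using gh(1) unfolding surj[symmetric] by (rule imageE)
    obtain q where q: "q \<in> carrier ?A" "h = f q"
      using gh(2) unfolding surj[symmetric] by (rule imageE)
    have "?g (f (p \<otimes>\<^bsub>?A\<^esub> q)) = p \<otimes>\<^bsub>?A\<^esub> q" "?g (f p) = p" "?g (f q) = q"
      using mult[OF p(1) q(1)] p(1) q(1) inv_into_f_f[OF inj] by blast+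
    then show "?g (g \<otimes> h) = ?g g \<otimes>\<^bsub>?A\<^esub> ?g h"
      using mult[OF p(1) q(1)] p(2) q(2) by simp
  qed (simp add: inv_into_into surj)
  then show ?thesis
    using bij_betw_inv_into[OF bij] by (auto simp: is_iso_def iso_def)
qed

text \<open>A non-trivial dilation fixes only \<open>z\<close>, so whatever conjugates one into another fixes \<open>z\<close> and is
  itself a dilation.\<close>

lemma conjugate_in_mult_of_coordinates:
  assumes ab: "a \<in> X" "a \<noteq> z" "a \<noteq> u" "b \<in> X" "b \<noteq> z"
    and conj: "conjugate_in G (dilation a) (dilation b)"
  shows "conjugate_in (mult_of coordinates) a b"
proof -
  interpret K: near_field coordinates by (rule near_field_coordinates)
  interpret M: group "mult_of coordinates" by (rule K.group_mult_of)
  note da = dilation[OF ab(1,2)] and db = dilation[OF ab(4,5)]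
  obtain g where g: "g \<in> carrier G" "dilation b = g \<otimes> dilation a \<otimes> inv g"
    using conj conjugate_in_iff da by auto
  have "dilation a \<noteq> \<one>" using da u ab act_one by metis
  then have "dilation b \<noteq> \<one>"
    using conj conjugate_in_one_iff da by blast
  moreover have "\<phi> (dilation b) (\<phi> g z) = \<phi> g z"
    using act_conjugate[of g "dilation a" z] g da z by simp
  ultimately have gz: "\<phi> g z = z"
    using unique_fixed_point[of "dilation b" "\<phi> g z" z] db g z act_closed by auto
  define c where "c = \<phi> g u"
  have c: "c \<in> X" "c \<noteq> z"
    using g gz act_neq_z[of g u] u z_neq_u unfolding c_def by auto
  have gc: "dilation c = g"
    using g gz unfolding c_def by (intro dilation_eqI) auto
  have "g \<otimes> dilation a = dilation b \<otimes> g"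
    using g da by (simp add: m_assoc)
  then have "\<phi> g (\<phi> (dilation a) u) = \<phi> (dilation b) (\<phi> g u)"
    using g da db u act_mult by metis
  then have "\<phi> (dilation c) a = \<phi> (dilation b) c"
    using gc da c_def by simp
  then have eq: "c \<otimes>\<^bsub>coordinates\<^esub> a = b \<otimes>\<^bsub>coordinates\<^esub> c"
    using ab c by (simp add: coordinates_def)
  have car: "a \<in> carrier (mult_of coordinates)" "b \<in> carrier (mult_of coordinates)"
    "c \<in> carrier (mult_of coordinates)"
    using ab c by (auto simp: coordinates_def)
  have "b = c \<otimes>\<^bsub>mult_of coordinates\<^esub> a \<otimes>\<^bsub>mult_of coordinates\<^esub> inv\<^bsub>mult_of coordinates\<^esub> c"
    using M.inv_solve_right[OF car(2) M.m_closed[OF car(3,1)] car(3)] eq by simp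
  then show ?thesis
    using M.conjugate_in_iff car by blast
qed

end

section \<open>Characteristic 2 with few conjugacy classes\<close>

text \<open>Distinct involutions have a product without fixed points, which the hypothesis \<open>free\<close> turns into
  an involution again. A group in which every element is its own inverse is abelian. Regularity says
  that exactly one involution swaps two given points.\<close>

lemma (in sharply_2_transitive_action) split_if_fixed_point_free_imp_involution:
  assumes char_2: "char_2_action G X \<phi>"
    and free: "\<And>g. g \<in> carrier G \<Longrightarrow> (\<And>x. x \<in> X \<Longrightarrow> \<phi> g x \<noteq> x) \<Longrightarrow> involution G g"
    and zu: "z \<in> X" "u \<in> X" "z \<noteq> u"
  shows "split_sharply_2_transitive_action G X \<phi> {g. g = \<one> \<or> involution G g} z u"
proof -
  let ?N = "{g. g = \<one> \<or> involution G g}"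
  have sq: "s \<in> carrier G \<and> s \<otimes> s = \<one>" if "s \<in> ?N" for s
    using that by (auto simp: involution_iff)
  have mult: "s \<otimes> t \<in> ?N" if st: "s \<in> ?N" "t \<in> ?N" for s t
  proof (cases "s = t \<or> s = \<one> \<or> t = \<one>")
    case True
    then show ?thesis using st sq[OF st(1)] sq[OF st(2)] by (elim disjE) simp_all
  next
    case False
    then have inv: "involution G s" "involution G t" using st by auto
    have "involution G (s \<otimes> t)"
    proof (rule free)
      show "s \<otimes> t \<in> carrier G" using sq[OF st(1)] sq[OF st(2)] by simp
      show "\<phi> (s \<otimes> t) x \<noteq> x" if "x \<in> X" for x
      proof (rule mult_involutions_has_no_fixed_point[OF inv _ _ that])
        show "s \<noteq> t" using False by simp
        show "\<phi> s y = y \<Longrightarrow> False" if "y \<in> X" for y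
          using char_2 inv(1) that by (simp add: char_2_action_def)
      qed
    qed
    then show ?thesis by simp
  qed
  have inv_eq: "inv s = s" if "s \<in> ?N" for s
    using sq[OF that] inv_equality by blast
  have sub: "subgroup ?N G"
  proof (rule subgroupI)
    show "?N \<subseteq> carrier G" using sq by blast
    show "?N \<noteq> {}" by blast
    show "inv s \<in> ?N" if "s \<in> ?N" for s
      unfolding inv_eq[OF that] by (rule that)
  qed (rule mult)
  have nrm: "?N \<lhd> G"
  proof (rule normal_inv_iff[THEN iffD2], intro conjI ballI)
    show "subgroup ?N G" by (rule sub)
  next
    fix g s assume g: "g \<in> carrier G" and s: "s \<in> ?N"
    then have "conjugate_in G s (g \<otimes> s \<otimes> inv g)"
      using sq conjugate_in_iff by blast
    then show "g \<otimes> s \<otimes> inv g \<in> ?N"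
      using conjugate_in_involution_iff[of s] conjugate_in_one_iff[of s] s sq[OF s] by simp
  qed
  show ?thesis
  proof (intro split_sharply_2_transitive_action.intro split_sharply_2_transitive_action_axioms.intro
      sharply_2_transitive_action_axioms nrm)
    show "s \<otimes> t = t \<otimes> s" if st: "s \<in> ?N" "t \<in> ?N" for s t
      using inv_eq[OF mult[OF st]] inv_eq[OF st(1)] inv_eq[OF st(2)] inv_mult_group[of s t]
        sq[OF st(1)] sq[OF st(2)] by simp
    show "\<exists>!t \<in> ?N. \<phi> t x = y" if xy: "x \<in> X" "y \<in> X" for x y
    proof (cases "x = y")
      case True
      show ?thesis
      proof (rule ex1I[of _ \<one>])
        show "t = \<one>" if "t \<in> ?N \<and> \<phi> t x = y" for t
          using that True xy char_2 unfolding char_2_action_def by auto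
      qed (use True xy act_one in simp)
    next
      case False
      then obtain i where i: "involution G i" "\<phi> i x = y"
        using involution_swapping xy by blast
      show ?thesis
      proof (rule ex1I[of _ i])
        show "t = i" if "t \<in> ?N \<and> \<phi> t x = y" for t
          using that i involutions_eq_if_agree[of t i x] xy False act_one by auto
      qed (use i in auto)
    qed
  qed (use zu in auto)
qed

lemma (in sharply_2_transitive_action) near_field_if_few_classes:
  assumes card_X: "has_at_least 3 X" and char_2: "char_2_action G X \<phi>"
    and few: "\<not> has_at_least 4 (conjugacy_classes G)"
  shows "\<exists>K :: 'c ring. near_field K \<and> G \<cong> near_field_affine_group K \<and>
    (\<forall>a \<in> carrier (mult_of K) - {\<one>\<^bsub>mult_of K\<^esub>}.
      \<forall>b \<in> carrier (mult_of K) - {\<one>\<^bsub>mult_of K\<^esub>}. conjugate_in (mult_of K) a b)"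
proof -
  obtain z where z: "z \<in> X"
    using has_at_least_avoid[OF two_points, of "{}"] by auto
  obtain u where u: "u \<in> X" "u \<noteq> z"
    using has_at_least_avoid[OF two_points, of "{z}"] by auto
  obtain i where i: "involution G i"
    using involution_swapping[of z u] z u by auto
  obtain g where g: "g \<in> carrier G" "g \<noteq> \<one>" "\<phi> g z = z"
    using element_fixing_point_outside[OF card_X, of "{}" z] z by auto
  have not_inv: "\<not> involution G h" if "\<phi> h x = x" "x \<in> X" for h x
    using char_2 that unfolding char_2_action_def by auto
  have conj: "conjugate_in G a b"
    if "a \<in> carrier G" "a \<noteq> \<one>" "\<not> involution G a"
      "b \<in> carrier G" "b \<noteq> \<one>" "\<not> involution G b" for a b
    using has_at_least_4_conjugacy_classes[OF i] that few by blast
  have free: "involution G h"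
    if h: "h \<in> carrier G" "\<And>x. x \<in> X \<Longrightarrow> \<phi> h x \<noteq> x" for h
  proof (rule ccontr)
    assume "\<not> involution G h"
    moreover have "h \<noteq> \<one>" using h z act_one by auto
    ultimately have "conjugate_in G g h"
      using conj g not_inv[OF g(3) z] h(1) by blast
    then show False
      using conjugate_has_fixed_point_iff[OF g(1)] g z h(2) by blast
  qed
  interpret split_sharply_2_transitive_action G X \<phi> "{g. g = \<one> \<or> involution G g}" z u
    using split_if_fixed_point_free_imp_involution[OF char_2 free] z u by auto
  have "conjugate_in (mult_of coordinates) a b"
    if ab: "a \<in> carrier (mult_of coordinates) - {\<one>\<^bsub>mult_of coordinates\<^esub>}"
      "b \<in> carrier (mult_of coordinates) - {\<one>\<^bsub>mult_of coordinates\<^esub>}" for a b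
  proof -
    have ab: "a \<in> X" "a \<noteq> z" "a \<noteq> u" "b \<in> X" "b \<noteq> z" "b \<noteq> u"
      using ab by (auto simp: coordinates_def)
    have dil: "dilation c \<in> carrier G \<and> dilation c \<noteq> \<one> \<and> \<not> involution G (dilation c)"
      if c: "c \<in> X" "c \<noteq> z" "c \<noteq> u" for c
      using dilation[OF c(1,2)] c(3) not_inv[OF _ z] act_one[OF u(1)] by metis
    show ?thesis
      using conjugate_in_mult_of_coordinates[OF ab(1-5)] conj dil ab by blast
  qed
  then show ?thesis
    using near_field_coordinates iso_near_field_affine_group by blast
qed

theorem proposition2p3:
  fixes G :: "('g, 'm) monoid_scheme" and X :: "'x set" and \<phi> :: "'g \<Rightarrow> 'x \<Rightarrow> 'x"
  assumes "sharply_2_transitive_action G X \<phi>"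
    and "has_at_least 4 X"
  shows "(\<not> char_2_action G X \<phi> \<longrightarrow> has_at_least 4 (conjugacy_classes G)) \<and>
    (char_2_action G X \<phi> \<longrightarrow>
      has_at_least 3 (conjugacy_classes G) \<and>
      (\<not> (\<exists>K :: 'x ring. near_field K \<and> G \<cong> near_field_affine_group K \<and>
            (\<forall>a \<in> carrier (mult_of K) - {\<one>\<^bsub>mult_of K\<^esub>}.
              \<forall>b \<in> carrier (mult_of K) - {\<one>\<^bsub>mult_of K\<^esub>}. conjugate_in (mult_of K) a b))
        \<longrightarrow> has_at_least 4 (conjugacy_classes G)))"
proof -
  interpret sharply_2_transitive_action G X \<phi> by (rule assms(1))
  have "has_at_least 3 X" using assms(2) by (auto simp: has_at_least_def)
  then show ?thesis
    using has_at_least_4_classes_if_not_char_2[OF assms(2)] has_at_least_3_classes_if_char_2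
      near_field_if_few_classes by blast
qed

end
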